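(* Let $|\mathbb{S}\rangle=(|1\rangle-|2\rangle)/\sqrt2\in\mathbb{C}^3$ be the Strange state, $\rho_0=|\mathbb{S}\rangle\langle\mathbb{S}|$, and let $\rho_1=(\mathbb{1}-|\mathbb{S}\rangle\langle\mathbb{S}|)/2$ be its orthogonal complement. Then for every qutrit magic state $\tau$ and for $k=1$ or $k=2$, the states $\rho_0\otimes\tau^{\otimes k}$ and $\rho_1\otimes\tau^{\otimes k}$ cannot be perfectly distinguished by PWF POVMs.
   Context: Qutrit means $\mathbb{C}^3$ ($d=3$) with computational basis $\{|0\rangle,|1\rangle,|2\rangle\}$. Phase-space operators. Let $X|j\rangle=|j+1 \bmod 3\rangle$, $Z|j\rangle=e^{2\pi i j/3}|j\rangle$. For $\mathbf{u}=(a_1,a_2)\in\mathbb{Z}_3\times\mathbb{Z}_3$ let $T_{\mathbf{u}}=e^{-4\pi i a_1a_2/3}Z^{a_1}X^{a_2}$, $A_{\mathbf{0}}=\frac13\sum_{\mathbf{u}}T_{\mathbf{u}}$, $A_{\mathbf{u}}=T_{\mathbf{u}}A_{\mathbf{0}}T_{\mathbf{u}}^\dagger$. On $m$ qutrits the phase-space points are $\mathbf{u}=(\mathbf{u}_1,\dots,\mathbf{u}_m)\in(\mathbb{Z}_3\times\mathbb{Z}_3)^m$ and $A_{\mathbf{u}}=A_{\mathbf{u}_1}\otimes\cdots\otimes A_{\mathbf{u}_m}$. The discrete Wigner function of a POVM effect $E$ is $W(E|\mathbf{u})=\operatorname{Tr}[EA_{\mathbf{u}}]$. A PWF POVM is a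 POVM each of whose effects $E$ satisfies $W(E|\mathbf{u})\ge0$ for all $\mathbf{u}$. Magic states. A pure qutrit stabilizer state is a rank-one projector of the form $\frac{1}{|G|}\sum_{g\in G} g$, where $G$ is a finite abelian group of unitaries, each a unit-modulus scalar multiple of some $T_{\mathbf{u}}$, containing no scalar operator other than the identity (so $|G|=3$). A qutrit magic state is a density operator on $\mathbb{C}^3$ (pure or mixed) not in the convex hull of the pure qutrit stabilizer states. Perfect discrimination. States $\sigma_0,\sigma_1$ can be perfectly distinguished by PWF POVMs if there is a two-outcome PWF POVM $\{E,\mathbb{1}-E\}$ with $\operatorname{Tr}(E\sigma_0)=1$ and $\operatorname{Tr}(E\sigma_1)=0$. *)

theory Defs
  imports "HOL-Analysis.Analysis" "HOL-Algebra.Group"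
begin

text \<open>
  The library type \<open>3\<close> is the ring \<open>\<int>/3\<close>; it indexes the computational basis of a qutrit, and
  a phase-space point of one qutrit is a pair in \<open>3 \<times> 3\<close>. A register of qutrits labelled by a
  finite type \<open>'m\<close> has its computational basis indexed by \<open>'m \<Rightarrow> 3\<close>, so that
  \<open>m = CARD('m)\<close>, and its phase-space points are the functions \<open>'m \<Rightarrow> 3 \<times> 3\<close>.
\<close>

type_synonym 'n cmat = "complex ^ 'n ^ 'n"

definition cscale :: "complex \<Rightarrow> 'n::finite cmat \<Rightarrow> 'n cmat" (infixr "*\<^sub>m" 75) where
  "c *\<^sub>m A = (\<chi> i j. c * A $ i $ j)"

text \<open>On \<^typ>\<open>complex ^ 'n ^ 'n\<close> the library's \<open>^\<close> would be the entrywise power.\<close>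

definition mpow :: "'n::finite cmat \<Rightarrow> nat \<Rightarrow> 'n cmat" where
  "mpow A n = (((**) A) ^^ n) (mat 1)"

definition dagger :: "'n::finite cmat \<Rightarrow> 'n cmat" where
  "dagger A = (\<chi> i j. cnj (A $ j $ i))"

definition braket :: "complex ^ 'n::finite \<Rightarrow> complex ^ 'n \<Rightarrow> complex" where
  "braket v w = (\<Sum>i\<in>UNIV. cnj (v $ i) * w $ i)"

definition ketbra :: "complex ^ 'n::finite \<Rightarrow> 'n cmat" where
  "ketbra v = (\<chi> i j. v $ i * cnj (v $ j))"

definition unitary :: "'n::finite cmat \<Rightarrow> bool" where
  "unitary U \<longleftrightarrow> U ** dagger U = mat 1 \<and> dagger U ** U = mat 1"

definition psd :: "'n::finite cmat \<Rightarrow> bool" where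
  "psd A \<longleftrightarrow> dagger A = A \<and> (\<forall>v. braket v (A *v v) \<in> \<real>\<^sub>\<ge>\<^sub>0)"

definition density_operator :: "'n::finite cmat \<Rightarrow> bool" where
  "density_operator \<rho> \<longleftrightarrow> psd \<rho> \<and> trace \<rho> = 1"

text \<open>The tensor product \<open>\<Otimes>\<^bsub>q\<^esub> F q\<close> over the qutrits \<open>q :: 'm\<close> of a register.\<close>

definition tensor :: "('m::finite \<Rightarrow> 3 cmat) \<Rightarrow> ('m \<Rightarrow> 3) cmat" where
  "tensor F = (\<chi> i j. \<Prod>q\<in>UNIV. F q $ i q $ j q)"


section \<open>Phase-space operators and Wigner function\<close>

text \<open>The representative in \<open>{0, 1, 2}\<close> of an element of \<open>\<int>/3\<close>.\<close>

definition rep3 :: "3 \<Rightarrow> nat" where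
  "rep3 a = nat (Rep_bit1 a)"

definition X_op :: "3 cmat" where
  "X_op = (\<chi> i j. if i = j + 1 then 1 else 0)"

definition Z_op :: "3 cmat" where
  "Z_op = (\<chi> i j. if i = j then exp (2 * of_real pi * \<i> * of_nat (rep3 j) / 3) else 0)"

definition T_op :: "3 \<times> 3 \<Rightarrow> 3 cmat" where
  "T_op u = exp (- (4 * of_real pi * \<i> * of_nat (rep3 (fst u)) * of_nat (rep3 (snd u)) / 3))
     *\<^sub>m (mpow Z_op (rep3 (fst u)) ** mpow X_op (rep3 (snd u)))"

definition A_zero :: "3 cmat" where
  "A_zero = (1/3) *\<^sub>m (\<Sum>u\<in>UNIV. T_op u)"

definition A_op :: "3 \<times> 3 \<Rightarrow> 3 cmat" where
  "A_op u = T_op u ** A_zero ** dagger (T_op u)"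

definition phase_point_op :: "('m::finite \<Rightarrow> 3 \<times> 3) \<Rightarrow> ('m \<Rightarrow> 3) cmat" where
  "phase_point_op u = tensor (\<lambda>q. A_op (u q))"

definition wigner_effect :: "('m::finite \<Rightarrow> 3) cmat \<Rightarrow> ('m \<Rightarrow> 3 \<times> 3) \<Rightarrow> complex" where
  "wigner_effect E u = trace (E ** phase_point_op u)"


section \<open>POVMs and perfect discrimination\<close>

definition povm :: "('o::finite \<Rightarrow> 'n::finite cmat) \<Rightarrow> bool" where
  "povm M \<longleftrightarrow> (\<forall>x. psd (M x)) \<and> (\<Sum>x\<in>UNIV. M x) = mat 1"

definition pwf_povm :: "('o::finite \<Rightarrow> ('m::finite \<Rightarrow> 3) cmat) \<Rightarrow> bool" where
  "pwf_povm M \<longleftrightarrow> povm M \<and> (\<forall>x u. wigner_effect (M x) u \<in> \<real>\<^sub>\<ge>\<^sub>0)"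

definition pwf_perfectly_distinguishable ::
    "('m::finite \<Rightarrow> 3) cmat \<Rightarrow> ('m \<Rightarrow> 3) cmat \<Rightarrow> bool" where
  "pwf_perfectly_distinguishable \<sigma>0 \<sigma>1 \<longleftrightarrow>
     (\<exists>E. pwf_povm (\<lambda>b::bool. if b then E else mat 1 - E)
        \<and> trace (E ** \<sigma>0) = 1 \<and> trace (E ** \<sigma>1) = 0)"


section \<open>Stabilizer and magic states of a qutrit\<close>

definition stabilizer_group :: "3 cmat set \<Rightarrow> bool" where
  "stabilizer_group G \<longleftrightarrow>
     finite G \<and> comm_group \<lparr>carrier = G, mult = (**), one = mat 1\<rparr>
     \<and> (\<forall>g\<in>G. unitary g \<and> (\<exists>c u. cmod c = 1 \<and> g = c *\<^sub>m T_op u))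
     \<and> (\<forall>c. mat c \<in> G \<longrightarrow> c = 1)"

text \<open>The rank condition excludes the trivial group, which would give the identity.\<close>

definition pure_stabilizer_state :: "3 cmat \<Rightarrow> bool" where
  "pure_stabilizer_state P \<longleftrightarrow>
     dagger P = P \<and> P ** P = P \<and> rank P = 1
     \<and> (\<exists>G. stabilizer_group G \<and> P = (1 / of_nat (card G)) *\<^sub>m (\<Sum>g\<in>G. g))"

definition magic_state :: "3 cmat \<Rightarrow> bool" where
  "magic_state \<tau> \<longleftrightarrow> density_operator \<tau> \<and> \<tau> \<notin> convex hull {P. pure_stabilizer_state P}"


section \<open>The two states to be distinguished\<close>

definition strange_ket :: "complex ^ 3" where
  "strange_ket = (1 / sqrt 2) *\<^sub>R (axis 1 1 - axis 2 1)"

definition rho0 :: "3 cmat" where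
  "rho0 = ketbra strange_ket"

definition rho1 :: "3 cmat" where
  "rho1 = (1/2) *\<^sub>m (mat 1 - ketbra strange_ket)"

text \<open>
  \<open>\<rho> \<otimes> \<tau>\<^sup>\<otimes>\<^sup>k\<close> with \<open>k = CARD('k)\<close>: the register \<open>'k option\<close> consists of the qutrit \<open>None\<close>, which
  carries \<open>\<rho>\<close>, and the \<open>k\<close> qutrits \<open>Some q\<close>, each carrying a copy of \<open>\<tau>\<close>.
\<close>

definition with_copies :: "3 cmat \<Rightarrow> 3 cmat \<Rightarrow> ('k::finite option \<Rightarrow> 3) cmat" where
  "with_copies \<rho> \<tau> = tensor (\<lambda>q. case q of None \<Rightarrow> \<rho> | Some _ \<Rightarrow> \<tau>)"

end

theory Submission
  imports Defs
begin

text \<open>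
  Since \<open>A\<^sub>0 = 2 \<rho>\<^sub>1 - \<rho>\<^sub>0\<close>, perfect discrimination forces \<open>Tr (E (A\<^sub>0 \<otimes> \<tau>\<^sup>\<otimes>\<^sup>k)) = -1\<close>.
  Expanding \<open>\<tau> = (1/3) \<Sum>\<^sub>u x\<^sub>u A\<^sub>u\<close> with \<open>x\<^sub>u = Tr (\<tau> A\<^sub>u)\<close>, this reads \<open>\<Sum>\<^sub>w W\<^sub>w e\<^sub>w = -1\<close>, where
  \<open>\<Sum>\<^sub>w W\<^sub>w = 1\<close>, \<open>\<Sum>\<^sub>w \<bar>W\<^sub>w\<bar> = ((1/3) \<Sum>\<^sub>u \<bar>x\<^sub>u\<bar>)\<^sup>k\<close>, and the Wigner values \<open>e\<^sub>w\<close> of \<open>E\<close> lie in \<open>[0, 1]\<close>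
  because \<open>E\<close> and \<open>1 - E\<close> both have nonnegative Wigner function. Hence
  \<open>3 = \<Sum>\<^sub>w W\<^sub>w (1 - 2 e\<^sub>w) \<le> ((1/3) \<Sum>\<^sub>u \<bar>x\<^sub>u\<bar>)\<^sup>k\<close>. On the other hand \<open>\<Sum>\<^sub>u x\<^sub>u = 3\<close> and
  \<open>\<Sum>\<^sub>u x\<^sub>u\<^sup>2 = 3 Tr \<tau>\<^sup>2 \<le> 3\<close>, so that \<open>(1/3) \<Sum>\<^sub>u \<bar>x\<^sub>u\<bar>\<close> is strictly below \<open>sqrt 3\<close>, a contradiction
  for \<open>k \<le> 2\<close>.
\<close>

section \<open>Arithmetic of \<open>\<int>/3\<close> and its additive character\<close>

lemma three_eq_zero: "(3::3) = 0" by simp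

lemma exhaust_Z3: "(a::3) = 0 \<or> a = 1 \<or> a = 2"
  using exhaust_3[of a] by auto

lemma rep3_simps [simp]: "rep3 0 = 0" "rep3 1 = 1" "rep3 2 = 2"
  by (simp_all add: rep3_def bit1.Rep_0 bit1.Rep_1 bit1.Rep_numeral)

lemma of_nat_rep3 [simp]: "of_nat (rep3 a) = a"
  using exhaust_Z3[of a] by auto

definition \<omega> :: complex where "\<omega> = cis (2 * pi / 3)"

lemma omega_cube [simp]: "\<omega> ^ 3 = 1"
  by (simp add: \<omega>_def Complex.DeMoivre)

lemma omega_neq_one: "\<omega> \<noteq> 1"
proof
  assume "\<omega> = 1"
  then have "Re \<omega> = 1" by simp
  then show False
    by (simp add: \<omega>_def cos_120)
qed

lemma sum_omega: "1 + \<omega> + \<omega>\<^sup>2 = 0"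
proof -
  have "(\<omega> - 1) * (1 + \<omega> + \<omega>\<^sup>2) = \<omega> ^ 3 - 1"
    by algebra
  then show ?thesis
    using omega_neq_one by simp
qed

lemma omega_power_mod: "\<omega> ^ n = \<omega> ^ (n mod 3)"
proof -
  have "\<omega> ^ n = \<omega> ^ (3 * (n div 3) + n mod 3)" by simp
  also have "\<dots> = \<omega> ^ (n mod 3)" by (simp only: power_add power_mult omega_cube power_one mult_1)
  finally show ?thesis .
qed

text \<open>A nontrivial additive character; phases can then be computed in the ring
  \<open>3\<close> rather than on representatives.\<close>

definition chi :: "3 \<Rightarrow> complex" where "chi a = \<omega> ^ rep3 a"

lemma chi_of_nat: "chi (of_nat n) = \<omega> ^ n"
proof -
  have "of_nat n = (of_nat (3 * (n div 3) + n mod 3) :: 3)" by simp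
  also have "\<dots> = 3 * of_nat (n div 3) + of_nat (n mod 3)"
    by (simp only: of_nat_add of_nat_mult of_nat_numeral)
  also have "\<dots> = of_nat (n mod 3)" by (simp only: three_eq_zero mult_zero_left add_0)
  finally have *: "(of_nat n :: 3) = of_nat (n mod 3)" .
  have "n mod 3 < 3" by simp
  then consider "n mod 3 = 0" | "n mod 3 = 1" | "n mod 3 = 2" by linarith
  then have "rep3 (of_nat (n mod 3)) = n mod 3" by cases auto
  then show ?thesis
    by (simp add: chi_def * omega_power_mod[of n])
qed

lemma chi_add: "chi (a + b) = chi a * chi b"
proof -
  have "chi (a + b) = chi (of_nat (rep3 a + rep3 b))" by simp
  also have "\<dots> = chi a * chi b"
    unfolding chi_of_nat power_add by (simp add: chi_def)
  finally show ?thesis .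
qed

lemma chi_zero [simp]: "chi 0 = 1"
  by (simp add: chi_def)

lemma norm_chi [simp]: "cmod (chi a) = 1"
  by (simp add: chi_def \<omega>_def norm_power)

lemma cnj_chi: "cnj (chi a) = chi (- a)"
proof -
  have "chi a * chi (- a) = 1" by (simp flip: chi_add)
  moreover have "chi a * cnj (chi a) = 1"
    by (simp add: complex_norm_square[symmetric])
  moreover have "chi a \<noteq> 0"
    using norm_chi[of a] by force
  ultimately show ?thesis
    by (metis mult_left_cancel)
qed

text \<open>Character orthogonality: for nonzero \<open>b\<close> the summands run through the three
  cube roots of unity, which add up to zero.\<close>

lemma sum_chi: "(\<Sum>a\<in>UNIV. chi (a * b)) = (if b = 0 then 3 else 0)"
proof -
  have "chi 1 = \<omega>" "chi 2 = \<omega>\<^sup>2"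
    by (simp_all add: chi_def)
  moreover have "(\<Sum>a\<in>UNIV. chi (a * b)) = 1 + chi b + chi (2 * b)"
    unfolding sum_3 three_eq_zero by simp
  \<comment> \<open>This serves the case \<open>b = 2\<close>, where the argument
    \<open>2 * b\<close> is 4.\<close>
  moreover have "chi 4 = chi 1" by (rule arg_cong[of _ _ chi]) simp
  ultimately show ?thesis
    using exhaust_Z3[of b] sum_omega by (elim disjE) (simp_all add: add_ac)
qed

section \<open>Matrix entries of the Weyl and phase-point operators\<close>

lemma mpow_Suc: "mpow A (Suc n) = A ** mpow A n" and mpow_0: "mpow A 0 = mat 1"
  by (simp_all add: mpow_def)

lemma Z_op_nth: "Z_op $ i $ j = (if i = j then chi i else 0)"
proof -
  have "exp (2 * of_real pi * \<i> * of_nat (rep3 i) / 3) = chi i"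
    by (simp add: chi_def \<omega>_def cis_conv_exp flip: exp_of_nat_mult) (simp add: algebra_simps)
  then show ?thesis
    by (auto simp: Z_op_def)
qed

lemma X_op_nth: "X_op $ i $ j = (if j = i - 1 then 1 else 0)"
  by (auto simp: X_op_def)

lemma mpow_Z_op: "mpow Z_op n $ i $ j = (if i = j then chi (of_nat n * i) else 0)"
proof (induction n arbitrary: i j)
  case 0 then show ?case by (simp add: mpow_0 mat_def)
next
  case (Suc n)
  then show ?case
    by (simp add: mpow_Suc matrix_matrix_mult_def Z_op_nth if_distrib[of "\<lambda>x. x * _"]
       if_distrib[of "\<lambda>x. _ * x"] chi_add distrib_right cong: if_cong)
qed

lemma mpow_X_op: "mpow X_op n $ i $ j = (if i = j + of_nat n then 1 else 0)"
proof (induction n arbitrary: i j)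
  case 0 then show ?case by (simp add: mpow_0 mat_def)
next
  case (Suc n)
  have "i - 1 = j + of_nat n \<longleftrightarrow> i = j + of_nat (Suc n)"
    by (auto simp: diff_eq_eq ac_simps)
  then show ?case
    by (simp add: mpow_Suc matrix_matrix_mult_def X_op_nth if_distrib[of "\<lambda>x. x * _"] Suc.IH
       del: of_nat_Suc cong: if_cong)
qed

text \<open>Since -2 = 1 modulo 3, the scalar prefactor of \<open>T_op\<close> is
  \<open>chi (a * b)\<close>; it merges with the entry \<open>chi (a * i)\<close> of the power of
  \<open>Z_op\<close>.\<close>

lemma T_op_nth: "T_op (a, b) $ i $ j = (if i = j + b then chi (a * (b + i)) else 0)"
proof -
  have 1: "exp (- (4 * of_real pi * \<i> / 3)) = \<omega>"
  proof -
    have "\<omega> * \<omega>\<^sup>2 = 1"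
      using omega_cube by (simp add: power3_eq_cube power2_eq_square mult.assoc)
    moreover have "exp (- (4 * of_real pi * \<i> / 3)) * \<omega>\<^sup>2 = 1"
      by (simp add: \<omega>_def cis_conv_exp flip: exp_of_nat_mult exp_add)
    moreover have "\<omega>\<^sup>2 \<noteq> 0" by (simp add: \<omega>_def)
    ultimately show ?thesis by (metis mult_right_cancel)
  qed
  have 2: "exp (- (4 * of_real pi * \<i> * of_nat (rep3 a) * of_nat (rep3 b) / 3)) = chi (a * b)"
  proof -
    have "exp (- (4 * of_real pi * \<i> * of_nat (rep3 a) * of_nat (rep3 b) / 3))
      = exp (of_nat (rep3 a * rep3 b) * - (4 * of_real pi * \<i> / 3))"
      by (simp add: algebra_simps)
    also have "\<dots> = chi (of_nat (rep3 a * rep3 b))"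
      unfolding exp_of_nat_mult 1 chi_of_nat ..
    finally show ?thesis by simp
  qed
  have "T_op (a, b) $ i $ j = chi (a * b) * (if i = j + b then chi (a * i) else 0)"
    by (simp add: T_op_def cscale_def 2 matrix_matrix_mult_def mpow_X_op mpow_Z_op
         if_distrib[of "\<lambda>x. x * _"] cong: if_cong)
  then show ?thesis
    by (simp only: distrib_left chi_add if_distrib[of "\<lambda>x. _ * x"] mult_zero_right)
qed

lemma sum_UNIV_prod: "(\<Sum>u\<in>(UNIV::('a::finite\<times>'b::finite) set). f u) = (\<Sum>a\<in>UNIV. \<Sum>b\<in>UNIV. f (a, b))"
  by (simp add: sum.cartesian_product flip: UNIV_Times_UNIV)

text \<open>The sum over \<open>b\<close> has one surviving term, and the remaining character sum
  over \<open>a\<close> vanishes unless \<open>2 * i = j\<close>, that is \<open>i + j = 0\<close>.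
  So \<open>A_zero\<close> is the parity operator.\<close>

lemma A_zero_nth: "A_zero $ i $ j = (if i + j = 0 then 1 else 0)"
proof -
  have inner: "(\<Sum>b\<in>UNIV. if i = j + b then chi (a * (b + i)) else 0) = chi (a * (i - j + i))" for a
  proof -
    have "i = j + b \<longleftrightarrow> b = i - j" for b by auto
    then show ?thesis by simp
  qed
  have "A_zero $ i $ j = 1/3 * (\<Sum>a\<in>UNIV. \<Sum>b\<in>UNIV. if i = j + b then chi (a * (b + i)) else 0)"
    by (simp add: A_zero_def cscale_def sum_UNIV_prod T_op_nth)
  also have "\<dots> = (if i - j + i = 0 then 1 else 0)"
    unfolding inner sum_chi by simp
  also have "i - j + i = 0 \<longleftrightarrow> i + j = 0"
    using exhaust_Z3[of i] exhaust_Z3[of j] by auto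
  finally show ?thesis .
qed

text \<open>Displacing parity by \<open>b\<close> gives the reflection about \<open>b\<close>; the
  phases of the two outer factors combine so that only \<open>i - j\<close> remains.\<close>

lemma A_op_nth: "A_op (a, b) $ i $ j = (if i + j = 2 * b then chi (a * (i - j)) else 0)"
proof -
  have *: "i = k + b \<longleftrightarrow> k = i - b" for i k :: 3 by auto
  have conj: "cnj (T_op (a, b) $ j $ k) = (if k = j - b then cnj (chi (a * (b + j))) else 0)" for j k
    by (simp add: T_op_nth *)
  have T: "T_op (a, b) $ i $ k = (if k = i - b then chi (a * (b + i)) else 0)" for i k
    by (simp add: T_op_nth *)
  have phase: "chi (a * (b + i)) * cnj (chi (a * (b + j))) = chi (a * (i - j))"
    by (simp add: cnj_chi flip: chi_add) (simp add: right_diff_distrib distrib_left)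
  have "i - b + (j - b) = i + j - 2 * b" by simp
  then have index: "i - b + (j - b) = 0 \<longleftrightarrow> i + j = 2 * b"
    by (metis eq_iff_diff_eq_0)
  have "A_op (a, b) $ i $ j = (\<Sum>k\<in>UNIV. (\<Sum>l\<in>UNIV. T_op (a, b) $ i $ l * A_zero $ l $ k) * cnj (T_op (a, b) $ j $ k))"
    by (simp add: A_op_def dagger_def matrix_matrix_mult_def)
  also have "\<dots> = chi (a * (b + i)) * A_zero $ (i - b) $ (j - b) * cnj (chi (a * (b + j)))"
    unfolding conj unfolding T
    by (simp add: if_distrib[of "\<lambda>x. x * _"] if_distrib[of "\<lambda>x. _ * x"] cong: if_cong)
  also have "\<dots> = A_zero $ (i - b) $ (j - b) * chi (a * (i - j))"
    by (simp flip: phase)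
  also have "\<dots> = (if i + j = 2 * b then chi (a * (i - j)) else 0)"
    by (simp add: A_zero_nth index)
  finally show ?thesis .
qed

section \<open>Phase-point operators as a Hermitian operator basis\<close>

lemma A_zero_eq_A_op: "A_zero = A_op (0, 0)"
  by (simp add: vec_eq_iff A_zero_nth A_op_nth)

text \<open>The reflection about \<open>b\<close> fixes only \<open>b\<close>, because 2 is
  invertible modulo 3, and the phase there is 1.\<close>

lemma trace_A_op [simp]: "trace (A_op u) = 1"
proof (cases u)
  case (Pair a b)
  have "i + i = 2 * b \<longleftrightarrow> i = b" for i
    using exhaust_Z3[of i] exhaust_Z3[of b] by auto
  then show ?thesis
    by (simp add: Pair trace_def A_op_nth)
qed

lemma dagger_A_op: "dagger (A_op u) = A_op u"
  by (cases u) (auto simp: vec_eq_iff dagger_def A_op_nth cnj_chi add.commute right_diff_distrib)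

text \<open>The tensor squares of the \<open>A_op u\<close> sum to three times the swap operator.
  The sum over \<open>b\<close> forces \<open>i + j = k + l\<close>, the character sum over
  \<open>a\<close> forces \<open>i - j + (k - l) = 0\<close>, and modulo 3 these two are solved only
  by \<open>i = l\<close>, \<open>j = k\<close>.\<close>

lemma A_op_complete:
  "(\<Sum>u\<in>UNIV. A_op u $ i $ j * A_op u $ k $ l) = (if i = l \<and> j = k then 3 else 0)"
proof -
  have collapse: "(\<Sum>b\<in>UNIV. (if s = 2 * b then x else 0) * (if t = 2 * b then y else 0))
      = (if s = t then x * y else 0)" for s t :: 3 and x y :: complex
  proof -
    \<comment> \<open>2 is its own inverse modulo 3.\<close>
    have half: "s = 2 * b \<longleftrightarrow> b = 2 * s" for s b :: 3
      using exhaust_Z3[of s] exhaust_Z3[of b] by auto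
    have double: "2 * s = 2 * t \<longleftrightarrow> s = t"
      using exhaust_Z3[of s] exhaust_Z3[of t] by auto
    have "(\<Sum>b\<in>UNIV. (if s = 2 * b then x else 0) * (if t = 2 * b then y else 0))
        = (\<Sum>b\<in>UNIV. if b = 2 * s then (if 2 * t = 2 * s then x * y else 0) else 0)"
      by (intro sum.cong refl) (auto simp: half[of s] half[of t])
    also have "\<dots> = (if s = t then x * y else 0)"
      using double by (simp add: eq_commute)
    finally show ?thesis .
  qed
  have inner: "(\<Sum>b\<in>UNIV. A_op (a, b) $ i $ j * A_op (a, b) $ k $ l)
      = (if i + j = k + l then chi (a * (i - j + (k - l))) else 0)" for a
    unfolding A_op_nth collapse by (simp only: distrib_left chi_add)
  have "(\<Sum>u\<in>UNIV. A_op u $ i $ j * A_op u $ k $ l)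
      = (if i + j = k + l then \<Sum>a\<in>UNIV. chi (a * (i - j + (k - l))) else 0)"
    unfolding sum_UNIV_prod inner by simp
  also have "\<dots> = (if i + j = k + l \<and> i - j + (k - l) = 0 then 3 else 0)"
    unfolding sum_chi by simp
  also have "i + j = k + l \<and> i - j + (k - l) = 0 \<longleftrightarrow> i = l \<and> j = k"
    using exhaust_Z3[of i] exhaust_Z3[of j] exhaust_Z3[of k] exhaust_Z3[of l]
    by (elim disjE) simp_all
  finally show ?thesis .
qed

text \<open>Wigner inversion, obtained by contracting \<open>A_op_complete\<close> with the entries
  of \<open>\<tau>\<close>.\<close>

lemma phase_point_expansion:
  fixes \<tau> :: "3 cmat"
  shows "\<tau> $ i $ j = (\<Sum>u\<in>UNIV. trace (\<tau> ** A_op u) / 3 * A_op u $ i $ j)"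
proof -
  have "(\<Sum>u\<in>UNIV. trace (\<tau> ** A_op u) / 3 * A_op u $ i $ j)
      = (\<Sum>u\<in>UNIV. \<Sum>k\<in>UNIV. \<Sum>l\<in>UNIV. \<tau> $ k $ l / 3 * (A_op u $ l $ k * A_op u $ i $ j))"
    by (simp add: trace_def matrix_matrix_mult_def sum_divide_distrib sum_distrib_right mult.assoc)
  also have "\<dots> = (\<Sum>k\<in>UNIV. \<Sum>l\<in>UNIV. \<tau> $ k $ l / 3 * (\<Sum>u\<in>UNIV. A_op u $ l $ k * A_op u $ i $ j))"
    by (subst sum.swap, intro sum.cong refl, subst sum.swap) (simp add: sum_distrib_left)
  also have "\<dots> = (\<Sum>k\<in>UNIV. \<Sum>l\<in>UNIV. if i = k then (if l = j then \<tau> $ k $ l else 0) else 0)"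
    unfolding A_op_complete by (intro sum.cong refl) auto
  also have "\<dots> = (\<Sum>k\<in>UNIV. if i = k then (\<Sum>l\<in>UNIV. if l = j then \<tau> $ k $ l else 0) else 0)"
    by (intro sum.cong refl) auto
  also have "\<dots> = \<tau> $ i $ j"
    by simp
  finally show ?thesis ..
qed

lemma cnj_trace: "cnj (trace A) = trace (dagger A)"
  by (simp add: trace_def dagger_def)

lemma dagger_mult: "dagger (A ** B) = dagger B ** dagger A"
  by (simp add: vec_eq_iff dagger_def matrix_matrix_mult_def mult.commute)

lemma trace_A_op_real:
  assumes "dagger \<tau> = \<tau>"
  shows "of_real (Re (trace (\<tau> ** A_op u))) = trace (\<tau> ** A_op u)"
proof -
  have "cnj (trace (\<tau> ** A_op u)) = trace (\<tau> ** A_op u)"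
    unfolding cnj_trace dagger_mult dagger_A_op assms by (rule trace_mul_sym)
  then show ?thesis
    by (simp add: complex_eq_iff)
qed

lemma sum_trace_A_op: "(\<Sum>u\<in>UNIV. trace (\<tau> ** A_op u)) = 3 * trace \<tau>"
proof -
  have "trace \<tau> = (\<Sum>i\<in>UNIV. \<Sum>u\<in>UNIV. trace (\<tau> ** A_op u) / 3 * A_op u $ i $ i)"
    unfolding trace_def[of \<tau>] by (intro sum.cong refl phase_point_expansion)
  also have "\<dots> = (\<Sum>u\<in>UNIV. trace (\<tau> ** A_op u) / 3 * trace (A_op u))"
    unfolding trace_def[of "A_op u" for u] sum_distrib_left by (rule sum.swap)
  finally show ?thesis
    by (simp add: mult.commute flip: sum_divide_distrib)
qed

text \<open>Parseval identity: the second factor of \<open>\<tau> ** \<tau>\<close> is replaced by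
  its phase-point expansion. It converts a purity bound into an l2 bound on Wigner values.\<close>

lemma sum_trace_A_op_square: "(\<Sum>u\<in>UNIV. (trace (\<tau> ** A_op u))\<^sup>2) = 3 * trace (\<tau> ** \<tau>)"
proof -
  have "trace (\<tau> ** \<tau>)
      = (\<Sum>i\<in>UNIV. \<Sum>j\<in>UNIV. \<tau> $ i $ j * (\<Sum>u\<in>UNIV. trace (\<tau> ** A_op u) / 3 * A_op u $ j $ i))"
    unfolding phase_point_expansion[of \<tau>, symmetric] by (simp add: trace_def matrix_matrix_mult_def)
  also have "\<dots> = (\<Sum>i\<in>UNIV. \<Sum>j\<in>UNIV. \<Sum>u\<in>UNIV. trace (\<tau> ** A_op u) / 3 * (\<tau> $ i $ j * A_op u $ j $ i))"
    by (simp add: sum_distrib_left mult_ac)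
  also have "\<dots> = (\<Sum>u\<in>UNIV. \<Sum>i\<in>UNIV. \<Sum>j\<in>UNIV. trace (\<tau> ** A_op u) / 3 * (\<tau> $ i $ j * A_op u $ j $ i))"
    by (subst (2) sum.swap, subst sum.swap) (rule refl)
  also have "\<dots> = (\<Sum>u\<in>UNIV. (trace (\<tau> ** A_op u))\<^sup>2 / 3)"
    unfolding sum_distrib_left[symmetric]
    by (intro sum.cong refl) (simp add: trace_def matrix_matrix_mult_def power2_eq_square)
  finally show ?thesis
    by (simp add: mult.commute flip: sum_divide_distrib)
qed

text \<open>Parity is -1 on the odd Strange state and 1 on its even orthogonal complement, and
  \<open>rho1\<close> is half the projector onto that complement.\<close>

lemma A_zero_eq_rho: "A_zero $ i $ j = 2 * rho1 $ i $ j - rho0 $ i $ j"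
proof -
  have sq: "complex_of_real (sqrt 2) * complex_of_real (sqrt 2) = 2"
    by (simp flip: of_real_mult)
  show ?thesis
    using exhaust_Z3[of i] exhaust_Z3[of j]
    by (elim disjE) (simp_all add: A_zero_nth rho1_def rho0_def cscale_def ketbra_def mat_def
       strange_ket_def axis_def scaleR_conv_of_real[where 'a=complex] sq)
qed

section \<open>Positive semidefinite matrices, purity, and the l1 bound on Wigner values\<close>

lemma psd_braket_nonneg: "psd A \<Longrightarrow> 0 \<le> Re (braket v (A *v v))"
  unfolding psd_def using complex_nonneg_Reals_iff by blast

text \<open>Nonnegativity of a principal 2 by 2 minor, read off from the quadratic form on vectors
  supported on \<open>i\<close> and \<open>j\<close>.\<close>

lemma psd_minor:
  assumes "psd A"
  shows "(cmod (A $ i $ j))\<^sup>2 \<le> Re (A $ i $ i) * Re (A $ j $ j)"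
proof -
  define c a d where "c = A $ i $ j" and "a = Re (A $ i $ i)" and "d = Re (A $ j $ j)"
  have herm: "A $ k $ l = cnj (A $ l $ k)" for k l
  proof -
    have "A $ k $ l = dagger A $ k $ l" using assms by (simp add: psd_def)
    then show ?thesis by (simp add: dagger_def)
  qed
  have diag: "A $ k $ k = of_real (Re (A $ k $ k))" for k
    using herm[of k k] by (simp add: complex_eq_iff)
  have form: "0 \<le> s\<^sup>2 * (cmod c)\<^sup>2 * a + 2 * s * (cmod c)\<^sup>2 + d" if "i \<noteq> j" for s :: real
  proof -
    \<comment> \<open>The factor \<open>c\<close> in coordinate \<open>i\<close> cancels the phase
      of the off-diagonal entry, so the form becomes a real polynomial in \<open>s\<close>.\<close>
    define v :: "complex ^ 'a" where
      "v = (\<chi> k. if k = i then of_real s * c else if k = j then 1 else 0)"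
    have sum: "(\<Sum>k\<in>UNIV. f k) = f i + f j" if "\<And>k. k \<noteq> i \<Longrightarrow> k \<noteq> j \<Longrightarrow> f k = 0" for f :: "'a \<Rightarrow> complex"
    proof -
      have "(\<Sum>k\<in>UNIV. f k) = (\<Sum>k\<in>{i, j}. f k)"
        by (rule sum.mono_neutral_right) (use that in auto)
      then show ?thesis using \<open>i \<noteq> j\<close> by simp
    qed
    have "(A *v v) $ k = A $ k $ i * (of_real s * c) + A $ k $ j" for k
      using \<open>i \<noteq> j\<close> by (simp add: matrix_vector_mult_def) (subst sum, auto simp: v_def)
    then have "braket v (A *v v)
        = cnj (of_real s * c) * (of_real a * (of_real s * c) + c) + (cnj c * (of_real s * c) + of_real d)"
      using \<open>i \<noteq> j\<close> herm[of j i] diag[of i] diag[of j]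
      by (simp add: braket_def) (subst sum, auto simp: v_def a_def d_def c_def)
    also have "\<dots> = of_real (s\<^sup>2 * (cmod c)\<^sup>2 * a + 2 * s * (cmod c)\<^sup>2 + d)"
      unfolding of_real_add of_real_mult complex_norm_square
      by (simp add: power2_eq_square algebra_simps)
    finally have "Re (braket v (A *v v)) = s\<^sup>2 * (cmod c)\<^sup>2 * a + 2 * s * (cmod c)\<^sup>2 + d"
      by simp
    moreover have "0 \<le> Re (braket v (A *v v))"
      using assms by (rule psd_braket_nonneg)
    ultimately show ?thesis by simp
  qed
  have nonneg: "0 \<le> Re (A $ k $ k)" for k
  proof -
    have "braket (axis k 1) (A *v axis k 1) = A $ k $ k"
      by (simp add: braket_def matrix_vector_mult_def axis_def if_distrib[of "\<lambda>x. _ * x"]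
        if_distrib[of "\<lambda>x. x * _"] if_distrib[of cnj] cong: if_cong)
    then show ?thesis
      using psd_braket_nonneg[OF assms, of "axis k 1"] by simp
  qed
  show ?thesis
  proof (cases "i = j")
    case True
    have "cmod (A $ j $ j) = \<bar>Re (A $ j $ j)\<bar>"
      by (metis diag norm_of_real)
    with True show ?thesis
      by (simp add: power2_eq_square)
  next
    case False
    have "(cmod c)\<^sup>2 \<le> a * d"
    proof (cases "a = 0")
      case True
      show ?thesis
      proof (rule ccontr)
        assume "\<not> ?thesis"
        then have pos: "(cmod c)\<^sup>2 > 0" using True by simp
        \<comment> \<open>With \<open>a = 0\<close> the form is linear in \<open>s\<close>; the
          chosen \<open>s\<close> gives it the value -1.\<close>
        then show False
          using form[OF False, of "- (d + 1) / (2 * (cmod c)\<^sup>2)"] True by (simp add: field_simps)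
      qed
    next
      case False
      then have "a > 0" using nonneg[of i] by (simp add: a_def)
      \<comment> \<open>The form is evaluated at \<open>s = - 1 / a\<close>, its minimiser when
        \<open>c\<close> is nonzero.\<close>
      then show ?thesis
        using form[OF \<open>i \<noteq> j\<close>, of "- 1 / a"] by (simp add: field_simps power2_eq_square)
    qed
    then show ?thesis by (simp add: a_def c_def d_def)
  qed
qed

text \<open>The trace of the square is the sum of all squared entry moduli; \<open>psd_minor\<close>
  bounds each one, and the bounds add up to the squared trace.\<close>

lemma density_operator_purity:
  assumes "density_operator \<rho>"
  shows "Re (trace (\<rho> ** \<rho>)) \<le> 1"
proof -
  have psd: "psd \<rho>" and tr: "trace \<rho> = 1" and herm: "dagger \<rho> = \<rho>"
    using assms by (auto simp: density_operator_def psd_def)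
  have *: "Re (\<rho> $ i $ j * \<rho> $ j $ i) = (cmod (\<rho> $ i $ j))\<^sup>2" for i j
  proof -
    have "\<rho> $ j $ i = cnj (\<rho> $ i $ j)"
    proof -
      have "\<rho> $ j $ i = dagger \<rho> $ j $ i" by (simp add: herm)
      then show ?thesis by (simp add: dagger_def)
    qed
    then show ?thesis by (simp add: cmod_def power2_eq_square)
  qed
  have "Re (trace (\<rho> ** \<rho>)) = (\<Sum>i\<in>UNIV. \<Sum>j\<in>UNIV. (cmod (\<rho> $ i $ j))\<^sup>2)"
    unfolding trace_def matrix_matrix_mult_def by (simp add: * del: times_complex.sel)
  also have "\<dots> \<le> (\<Sum>i\<in>UNIV. \<Sum>j\<in>UNIV. Re (\<rho> $ i $ i) * Re (\<rho> $ j $ j))"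
    by (intro sum_mono psd_minor psd)
  also have "\<dots> = (Re (trace \<rho>))\<^sup>2"
    by (simp add: trace_def power2_eq_square sum_product)
  finally show ?thesis by (simp add: tr)
qed

text \<open>Cauchy--Schwarz gives the bound \<open>3 * sqrt 3\<close>. Equality would force every \<open>x u\<close> to be
  \<open>\<plusminus>1 / sqrt 3\<close>, so \<open>27\<close> would be the square of an integer.\<close>

lemma sum_abs_less_3_sqrt_3:
  fixes x :: "'a::finite \<Rightarrow> real"
  assumes card: "CARD('a) = 9" and sum: "(\<Sum>u\<in>UNIV. x u) = 3" and sq: "(\<Sum>u\<in>UNIV. (x u)\<^sup>2) \<le> 3"
  shows "(\<Sum>u\<in>UNIV. \<bar>x u\<bar>) < 3 * sqrt 3"
proof (rule ccontr)
  assume neg: "\<not> ?thesis"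
  \<comment> \<open>The Cauchy-Schwarz deficit as a sum of squares; under the negated claim it is at
    most 9 - 18 + 9.\<close>
  have "(\<Sum>u\<in>UNIV. (sqrt 3 * \<bar>x u\<bar> - 1)\<^sup>2) = 3 * (\<Sum>u\<in>UNIV. (x u)\<^sup>2) - 2 * sqrt 3 * (\<Sum>u\<in>UNIV. \<bar>x u\<bar>) + 9"
    by (simp add: power2_diff power_mult_distrib sum.distrib sum_subtractf card sum_distrib_left mult_ac)
  moreover have "2 * sqrt 3 * (3 * sqrt 3) \<le> 2 * sqrt 3 * (\<Sum>u\<in>UNIV. \<bar>x u\<bar>)"
    using neg by (intro mult_left_mono) auto
  ultimately have "(\<Sum>u\<in>UNIV. (sqrt 3 * \<bar>x u\<bar> - 1)\<^sup>2) \<le> 0"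
    using sq by simp
  then have "(\<Sum>u\<in>UNIV. (sqrt 3 * \<bar>x u\<bar> - 1)\<^sup>2) = 0"
    by (meson antisym sum_nonneg zero_le_power2)
  then have abs1: "\<bar>sqrt 3 * x u\<bar> = 1" for u
    by (simp add: sum_nonneg_eq_0_iff abs_mult)
  then have "sqrt 3 * x u = of_int (if x u > 0 then 1 else - 1)" for u
  proof (cases "x u > 0")
    case True
    then show ?thesis using abs1[of u] by (simp add: abs_mult)
  next
    case False
    then show ?thesis using abs1[of u] by (simp add: abs_mult)
  qed
  then have "sqrt 3 * (\<Sum>u\<in>UNIV. x u) = of_int (\<Sum>u\<in>UNIV. if x u > 0 then 1 else - 1)"
    by (simp add: sum_distrib_left)
  then obtain n :: int where n: "sqrt 3 * 3 = of_int n"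
    unfolding sum by blast
  have "real_of_int (n\<^sup>2) = (sqrt 3 * 3)\<^sup>2"
    by (simp add: n)
  also have "\<dots> = of_int 27"
    by (simp add: power_mult_distrib)
  finally have "n\<^sup>2 = 27"
    by linarith
  then have sq27: "\<bar>n\<bar>\<^sup>2 = 27" by simp
  \<comment> \<open>27 lies strictly between the consecutive squares 25 and 36.\<close>
  have "\<bar>n\<bar> \<le> 5 \<or> 6 \<le> \<bar>n\<bar>" by linarith
  then show False
    using sq27 power_mono[of "\<bar>n\<bar>" 5 2] power_mono[of 6 "\<bar>n\<bar>" 2] by auto
qed

section \<open>Wigner expansions on registers and the discrimination argument\<close>

text \<open>Multilinearity: a product over qutrits of sums over single phase-space points is a sum
  over points \<open>w\<close> of the whole register.\<close>

lemma trace_tensor_expansion: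
  fixes E :: "('m::finite \<Rightarrow> 3) cmat"
  assumes "\<And>q i j. F q $ i $ j = (\<Sum>u\<in>UNIV. c q u * A_op u $ i $ j)"
  shows "trace (E ** tensor F) = (\<Sum>w\<in>UNIV. (\<Prod>q\<in>UNIV. c q (w q)) * wigner_effect E w)"
proof -
  have entry: "tensor F $ i $ j = (\<Sum>w\<in>UNIV. (\<Prod>q\<in>UNIV. c q (w q)) * phase_point_op w $ i $ j)" for i j
    by (simp add: tensor_def phase_point_op_def assms prod_sum_PiE PiE_UNIV_domain prod.distrib)
  have "trace (E ** tensor F)
      = (\<Sum>i\<in>UNIV. \<Sum>j\<in>UNIV. \<Sum>w\<in>UNIV. (\<Prod>q\<in>UNIV. c q (w q)) * (E $ i $ j * phase_point_op w $ j $ i))"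
    unfolding trace_def matrix_matrix_mult_def by (simp add: entry sum_distrib_left mult_ac)
  also have "\<dots> = (\<Sum>w\<in>UNIV. \<Sum>i\<in>UNIV. \<Sum>j\<in>UNIV. (\<Prod>q\<in>UNIV. c q (w q)) * (E $ i $ j * phase_point_op w $ j $ i))"
    by (subst (2) sum.swap, subst sum.swap) (rule refl)
  also have "\<dots> = (\<Sum>w\<in>UNIV. (\<Prod>q\<in>UNIV. c q (w q)) * wigner_effect E w)"
    unfolding sum_distrib_left[symmetric]
    by (simp add: wigner_effect_def trace_def matrix_matrix_mult_def)
  finally show ?thesis .
qed

lemma sum_prod_fun:
  fixes f :: "'m::finite \<Rightarrow> 'b::finite \<Rightarrow> 'c::comm_semiring_1"
  shows "(\<Sum>w\<in>UNIV. \<Prod>q\<in>UNIV. f q (w q)) = (\<Prod>q\<in>UNIV. \<Sum>u\<in>UNIV. f q u)"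
  by (simp add: prod_sum_PiE PiE_UNIV_domain)

lemma prod_option: "(\<Prod>q\<in>(UNIV :: 'k::finite option set). f q) = f None * (\<Prod>q\<in>UNIV. f (Some q))"
  by (simp add: UNIV_option_conv prod.reindex)

lemma sum_abs_trace_A_op_less:
  assumes "density_operator \<tau>"
  shows "(\<Sum>u\<in>UNIV. \<bar>Re (trace (\<tau> ** A_op u))\<bar>) < 3 * sqrt 3"
proof (rule sum_abs_less_3_sqrt_3)
  have herm: "dagger \<tau> = \<tau>" and tr: "trace \<tau> = 1"
    using assms by (auto simp: density_operator_def psd_def)
  show "CARD(3 \<times> 3) = 9" by simp
  show "(\<Sum>u\<in>UNIV. Re (trace (\<tau> ** A_op u))) = 3"
    unfolding Re_sum[symmetric] sum_trace_A_op tr by simp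
  have "complex_of_real (\<Sum>u\<in>UNIV. (Re (trace (\<tau> ** A_op u)))\<^sup>2) = 3 * trace (\<tau> ** \<tau>)"
    by (simp add: trace_A_op_real[OF herm] sum_trace_A_op_square)
  then have "Re (complex_of_real (\<Sum>u\<in>UNIV. (Re (trace (\<tau> ** A_op u)))\<^sup>2)) = Re (3 * trace (\<tau> ** \<tau>))"
    by (rule arg_cong)
  then have "(\<Sum>u\<in>UNIV. (Re (trace (\<tau> ** A_op u)))\<^sup>2) = 3 * Re (trace (\<tau> ** \<tau>))"
    unfolding Re_complex_of_real by simp
  then show "(\<Sum>u\<in>UNIV. (Re (trace (\<tau> ** A_op u)))\<^sup>2) \<le> 3"
    using density_operator_purity[OF assms] by simp
qed

lemma with_copies_A_zero:
  "with_copies A_zero \<tau> = 2 *\<^sub>m with_copies rho1 \<tau> - with_copies rho0 \<tau>"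
  by (simp add: vec_eq_iff with_copies_def tensor_def cscale_def prod_option A_zero_eq_rho algebra_simps)

text \<open>The trace factorises over the qutrits. This turns Wigner positivity of
  \<open>mat 1 - E\<close> into the upper bound 1 for the Wigner values of \<open>E\<close>.\<close>

lemma wigner_effect_mat_1: "wigner_effect (mat 1) w = 1"
proof -
  have "wigner_effect (mat 1) w = (\<Sum>i\<in>UNIV. \<Prod>q\<in>UNIV. A_op (w q) $ i q $ i q)"
    by (simp add: wigner_effect_def trace_def phase_point_op_def tensor_def)
  also have "\<dots> = (\<Prod>q\<in>UNIV. trace (A_op (w q)))"
    unfolding trace_def by (rule sum_prod_fun)
  finally show ?thesis by simp
qed

lemma wigner_effect_diff: "wigner_effect (E - F) w = wigner_effect E w - wigner_effect F w"
  by (simp add: wigner_effect_def trace_def matrix_matrix_mult_def left_diff_distrib sum_subtractf)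

theorem proposition7:
  fixes \<tau> :: "3 cmat"
  assumes "magic_state \<tau>"
    and "CARD('k::finite) = 1 \<or> CARD('k) = 2"
  shows "\<not> pwf_perfectly_distinguishable
           (with_copies rho0 \<tau> :: ('k option \<Rightarrow> 3) cmat)
           (with_copies rho1 \<tau> :: ('k option \<Rightarrow> 3) cmat)"
proof
  assume "pwf_perfectly_distinguishable
           (with_copies rho0 \<tau> :: ('k option \<Rightarrow> 3) cmat)
           (with_copies rho1 \<tau> :: ('k option \<Rightarrow> 3) cmat)"
  then obtain E :: "('k option \<Rightarrow> 3) cmat"
    where pwf: "pwf_povm (\<lambda>b::bool. if b then E else mat 1 - E)"
      and E0: "trace (E ** with_copies rho0 \<tau>) = 1" and E1: "trace (E ** with_copies rho1 \<tau>) = 0"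
    unfolding pwf_perfectly_distinguishable_def by blast
  have dens: "density_operator \<tau>"
    using assms(1) by (simp add: magic_state_def)
  then have herm: "dagger \<tau> = \<tau>" and tr: "trace \<tau> = 1"
    by (auto simp: density_operator_def psd_def)
  define x where "x u = Re (trace (\<tau> ** A_op u))" for u
  \<comment> \<open>Qutrit \<open>None\<close> carries \<open>A_zero\<close>, itself the phase-point
    operator at the origin, hence a point mass; a copy of \<open>\<tau>\<close> contributes its
    expansion coefficients.\<close>
  define c where "c q u = (case q of None \<Rightarrow> of_bool (u = (0, 0)) | Some _ \<Rightarrow> x u / 3)"
    for q :: "'k option" and u
  define W where "W w = (\<Prod>q\<in>UNIV. c q (w q))" for w
  define e where "e w = Re (wigner_effect E w)" for w

  have "wigner_effect (if b then E else mat 1 - E) w \<in> \<real>\<^sub>\<ge>\<^sub>0" for b :: bool and w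
    using pwf by (simp add: pwf_povm_def)
  from this[of True] this[of False]
  have wigner: "wigner_effect E w \<in> \<real>\<^sub>\<ge>\<^sub>0" "1 - wigner_effect E w \<in> \<real>\<^sub>\<ge>\<^sub>0" for w
    by (simp_all add: wigner_effect_diff wigner_effect_mat_1)
  then have e_bounds: "0 \<le> e w" "e w \<le> 1" and e: "wigner_effect E w = of_real (e w)" for w
    by (auto simp: e_def complex_nonneg_Reals_iff complex_eq_iff)

  have "trace (E ** with_copies A_zero \<tau>) = (\<Sum>w\<in>UNIV. (\<Prod>q\<in>UNIV. of_real (c q (w q))) * wigner_effect E w)"
    unfolding with_copies_def
  proof (rule trace_tensor_expansion)
    fix q :: "'k option" and i j
    show "(case q of None \<Rightarrow> A_zero | Some _ \<Rightarrow> \<tau>) $ i $ j = (\<Sum>u\<in>UNIV. of_real (c q u) * A_op u $ i $ j)"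
    proof (cases q)
      case None
      then show ?thesis
        by (simp add: c_def A_zero_eq_A_op of_bool_def if_distrib[of of_real] if_distrib[of "\<lambda>x. x * _"] cong: if_cong)
    next
      case (Some p)
      then show ?thesis
        using phase_point_expansion[of \<tau> i j] by (simp add: c_def x_def trace_A_op_real[OF herm])
    qed
  qed
  moreover have "trace (E ** with_copies A_zero \<tau>) = - 1"
  proof -
    have "trace (E ** with_copies A_zero \<tau>) = 2 * trace (E ** with_copies rho1 \<tau>) - trace (E ** with_copies rho0 \<tau>)"
      unfolding with_copies_A_zero
      by (simp add: trace_def matrix_matrix_mult_def cscale_def right_diff_distrib sum_subtractf
          sum_distrib_left mult_ac)
    then show ?thesis by (simp add: E0 E1)
  qed
  ultimately have "complex_of_real (\<Sum>w\<in>UNIV. W w * e w) = of_real (- 1)"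
    by (simp add: W_def e)
  then have We: "(\<Sum>w\<in>UNIV. W w * e w) = - 1"
    by (simp only: of_real_eq_iff)

  have c_sum: "(\<Sum>u\<in>UNIV. c q u) = 1" for q
  proof (cases q)
    case None
    then show ?thesis by (simp add: c_def of_bool_def)
  next
    case (Some p)
    have "(\<Sum>u\<in>UNIV. x u) = 3"
      unfolding x_def Re_sum[symmetric] sum_trace_A_op tr by simp
    with Some show ?thesis by (simp add: c_def flip: sum_divide_distrib)
  qed
  have W_sum: "(\<Sum>w\<in>UNIV. W w) = 1"
    unfolding W_def sum_prod_fun c_sum by simp

  define N where "N = (\<Sum>u\<in>UNIV. \<bar>x u\<bar>) / 3"
  have "N < sqrt 3"
    using sum_abs_trace_A_op_less[OF dens] by (simp add: N_def x_def)
  moreover have "0 \<le> N" by (simp add: N_def sum_nonneg)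
  ultimately have "N\<^sup>2 < 3"
    using power_strict_mono[of N "sqrt 3" 2] by simp
  \<comment> \<open>For one copy the final bound is \<open>N < sqrt 3 < 3\<close>; for two copies it
    is \<open>N\<^sup>2 < 3\<close>.\<close>
  have "sqrt 3 < 3"
    using real_sqrt_less_mono[of 3 9] by simp
  \<comment> \<open>The l1 norm factorises too: the point mass at \<open>None\<close> contributes 1
    and every copy contributes \<open>N\<close>.\<close>
  have W_abs: "(\<Sum>w\<in>UNIV. \<bar>W w\<bar>) = N ^ CARD('k)"
  proof -
    have "(\<Sum>u\<in>UNIV. \<bar>c None u\<bar>) = 1"
      by (simp add: c_def of_bool_def if_distrib[of abs] cong: if_cong)
    moreover have "(\<Sum>u\<in>UNIV. \<bar>c (Some p) u\<bar>) = N" for p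
      by (simp add: c_def N_def sum_divide_distrib)
    moreover have "(\<Sum>w\<in>UNIV. \<bar>W w\<bar>) = (\<Prod>q\<in>UNIV. \<Sum>u\<in>UNIV. \<bar>c q u\<bar>)"
      unfolding W_def abs_prod by (rule sum_prod_fun)
    ultimately show ?thesis
      by (simp add: prod_option)
  qed

  \<comment> \<open>The map sending \<open>e\<close> to \<open>1 - 2 * e\<close> recentres
    \<open>[0, 1]\<close> to \<open>[-1, 1]\<close>, so the l1 norm of \<open>W\<close> bounds the
    sum, whose value is 1 + 2 = 3.\<close>
  have "(\<Sum>w\<in>UNIV. W w * (1 - 2 * e w)) = (\<Sum>w\<in>UNIV. W w) - 2 * (\<Sum>w\<in>UNIV. W w * e w)"
    by (simp add: right_diff_distrib sum_subtractf sum_distrib_left mult.left_commute)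
  then have "3 = (\<Sum>w\<in>UNIV. W w * (1 - 2 * e w))"
    unfolding W_sum We by simp
  also have "\<dots> \<le> (\<Sum>w\<in>UNIV. \<bar>W w\<bar>)"
  proof (rule sum_mono)
    fix w
    have "\<bar>1 - 2 * e w\<bar> \<le> 1" using e_bounds[of w] by (simp add: abs_le_iff)
    then have "\<bar>W w\<bar> * \<bar>1 - 2 * e w\<bar> \<le> \<bar>W w\<bar> * 1"
      by (intro mult_left_mono) auto
    then show "W w * (1 - 2 * e w) \<le> \<bar>W w\<bar>"
      by (metis abs_le_D1 abs_mult mult.right_neutral)
  qed
  also have "\<dots> < 3"
    using assms(2) \<open>N < sqrt 3\<close> \<open>sqrt 3 < 3\<close> \<open>N\<^sup>2 < 3\<close> unfolding W_abs by auto
  finally show False by simp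
qed

end
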